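(* Let $A$ be a semiprime coherent quantale. The following are equivalent: (1) $A$ is a purified quantale; (2) $A$ is an $mp$-quantale and $\mathrm{Min}_F(A)$ is totally separated; (3) $A$ is an $mp$-quantale and $\mathrm{Min}_F(A)$ is totally disconnected; (4) $A$ is an $mp$-quantale and $\mathrm{Min}_F(A)$ is a Boolean space; (5) the family $(V(e)\cap \mathrm{Min}(A))_{e\in B(A)}$ is a basis of open sets for $\mathrm{Min}_F(A)$; (6) every minimal $m$-prime element $p$ of $A$ is regular; (7) $\mathrm{Min}(A)=\mathrm{Sp}(A)$; (8) $A$ is an $mp$-quantale and every pure element of $A$ is regular.
   Context: A quantale is a complete lattice $(A,\vee,\wedge,0,1)$ with an associative multiplication distributing over arbitrary joins in each variable. All quantales are assumed commutative and integral ($1$ is the multiplicative unit). $K(A)$ is the set of compact elements. $A$ is algebraic if every element is a join of compact elements; $A$ is coherent if it is algebraic, $1\in K(A)$ and $K(A)$ is closed under multiplication. $a^{\perp}=\bigvee\{x\in A: ax=0\}$. $B(A)$ is the Boolean algebra of complemented elements of $A$ (those $e$ with $e\vee e^{\perp}=1$), with complement $\neg e=e^{\perp}$. An element $p<1$ is $m$-prime if $ab\le p$ implies $a\le p$ or $b\le p$; $\mathrm{Spec}(A)$ is the set of $m$-prime elements and $\mathrm{Min}(A)$ the set of minimal ones. $A$ is semiprime if $\bigwedge \mathrm{Spec}(A)=0$. For $c\in A$, $V(c)=\{p\in\mathrm{Spec}(A): c\le p\}$. The flat topology on $\mathrm{Spec}(A)$ has $\{V(c): c\in K(A)\}$ as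 a basis of open sets, and $\mathrm{Min}_F(A)$ is $\mathrm{Min}(A)$ with the subspace topology. $A$ is an $mp$-quantale if for every $p\in \mathrm{Spec}(A)$ there is a unique $q\in \mathrm{Min}(A)$ with $q\le p$. $A$ is purified if for all distinct $p,q\in \mathrm{Min}(A)$ there is $e\in B(A)$ with $e\le p$ and $\neg e\le q$. An element $a$ is pure if for all $c\in K(A)$, $c\le a$ implies $a\vee c^{\perp}=1$. An element is regular if it is a join of complemented elements; $\mathrm{Sp}(A)$ is the set of max-regular elements, i.e. the maximal elements of the set of regular elements different from $1$. A space is totally disconnected if its only connected subsets are single points; totally separated if for all distinct points $x,y$ there is a clopen set containing $x$ but not $y$; Boolean if it is compact, Hausdorff and has a basis of clopen sets. *)

theory Defs
  imports "HOL-Analysis.Analysis"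
begin

text \<open>
  Commutative integral quantales. The least and greatest elements are written \<open>bot\<close> and \<open>top\<close>;
  integrality is the axiom \<open>1 = top\<close>. By commutativity, distributivity of multiplication over
  arbitrary joins is only required in the second variable. The one-element quantale is allowed.
\<close>

class quantale = complete_lattice + comm_monoid_mult +
  assumes mult_Sup: "a * Sup X = (SUP x\<in>X. a * x)"
    and one_eq_top: "1 = top"

definition compact_elems :: "'a::quantale set" where
  "compact_elems = {c. \<forall>X. c \<le> Sup X \<longrightarrow> (\<exists>Y. finite Y \<and> Y \<subseteq> X \<and> c \<le> Sup Y)}"

text \<open>Properties of the quantale as a whole take its carrier type as an argument.\<close>

definition algebraic :: "'a::quantale itself \<Rightarrow> bool" where
  "algebraic _ \<longleftrightarrow> (\<forall>a::'a. \<exists>X \<subseteq> compact_elems. a = Sup X)"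

definition coherent :: "'a::quantale itself \<Rightarrow> bool" where
  "coherent A \<longleftrightarrow> algebraic A \<and> (1::'a) \<in> compact_elems \<and>
     (\<forall>c\<in>compact_elems. \<forall>d\<in>compact_elems. (c * d :: 'a) \<in> compact_elems)"

definition annih :: "'a::quantale \<Rightarrow> 'a" where
  "annih a = Sup {x. a * x = bot}"

definition complemented :: "'a::quantale set" where
  "complemented = {e. sup e (annih e) = 1}"

definition Spec :: "'a::quantale set" where
  "Spec = {p. p < 1 \<and> (\<forall>a b. a * b \<le> p \<longrightarrow> a \<le> p \<or> b \<le> p)}"

definition Min_Spec :: "'a::quantale set" where
  "Min_Spec = {p \<in> Spec. \<forall>q\<in>Spec. q \<le> p \<longrightarrow> q = p}"

definition semiprime :: "'a::quantale itself \<Rightarrow> bool" where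
  "semiprime _ \<longleftrightarrow> Inf (Spec :: 'a set) = bot"

definition V :: "'a::quantale \<Rightarrow> 'a set" where
  "V c = {p \<in> Spec. c \<le> p}"

definition is_basis :: "'b topology \<Rightarrow> 'b set set \<Rightarrow> bool" where
  "is_basis X \<B> \<longleftrightarrow> openin X = arbitrary union_of (\<lambda>U. U \<in> \<B>)"

definition flat_topology :: "'a::quantale topology" where
  "flat_topology = topology (arbitrary union_of (\<lambda>U. U \<in> V ` compact_elems))"

definition MinF :: "'a::quantale topology" where
  "MinF = subtopology flat_topology Min_Spec"

text \<open>
  The operator \<open>topology\<close> is only meaningful on families satisfying the axioms of a topology.
  The next facts confirm that this is the case for \<open>flat_topology\<close>.
\<close>

lemma bot_compact: "bot \<in> (compact_elems :: 'a::quantale set)"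
  unfolding compact_elems_def by (auto intro!: exI[of _ "{}"])

lemma sup_compact:
  fixes c d :: "'a::quantale"
  assumes "c \<in> compact_elems" "d \<in> compact_elems"
  shows "sup c d \<in> compact_elems"
  unfolding compact_elems_def
proof (intro CollectI allI impI)
  fix X :: "'a set"
  assume "sup c d \<le> Sup X"
  then have "c \<le> Sup X" "d \<le> Sup X" by auto
  from \<open>c \<le> Sup X\<close> obtain Y where Y: "finite Y" "Y \<subseteq> X" "c \<le> Sup Y"
    using assms(1) by (auto simp: compact_elems_def)
  from \<open>d \<le> Sup X\<close> obtain Z where Z: "finite Z" "Z \<subseteq> X" "d \<le> Sup Z"
    using assms(2) by (auto simp: compact_elems_def)
  have "sup c d \<le> Sup (Y \<union> Z)"
    using Y(3) Z(3) by (simp add: Sup_union_distrib sup.coboundedI1 sup.coboundedI2)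
  then show "\<exists>Y. finite Y \<and> Y \<subseteq> X \<and> sup c d \<le> Sup Y"
    using Y Z by (intro exI[of _ "Y \<union> Z"]) auto
qed

lemma is_basis_flat_topology:
  "is_basis (flat_topology :: 'a::quantale topology) (V ` compact_elems)"
proof -
  have "istopology (arbitrary union_of (\<lambda>U. U \<in> V ` (compact_elems :: 'a set)))"
  proof (rule istopology_base)
    fix S T :: "'a set"
    assume "S \<in> V ` compact_elems" "T \<in> V ` compact_elems"
    then obtain c d where cd: "S = V c" "T = V d" "c \<in> compact_elems" "d \<in> compact_elems"
      by auto
    then have "S \<inter> T = V (sup c d)" by (auto simp: V_def)
    then show "S \<inter> T \<in> V ` compact_elems" using cd sup_compact by blast
  qed
  then show ?thesis
    unfolding is_basis_def flat_topology_def by (simp add: topology_inverse')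
qed

lemma topspace_flat_topology: "topspace (flat_topology :: 'a::quantale topology) = Spec"
proof
  obtain \<U> where "\<U> \<subseteq> V ` compact_elems" "\<Union>\<U> = topspace (flat_topology :: 'a topology)"
    using openin_topspace[of "flat_topology :: 'a topology"]
      is_basis_flat_topology[where 'a = 'a]
    unfolding is_basis_def union_of_def arbitrary_def by auto
  then show "topspace flat_topology \<subseteq> (Spec :: 'a set)"
    by (force simp: V_def)
  have "V bot = (Spec :: 'a set)" by (auto simp: V_def)
  then have "openin flat_topology (Spec :: 'a set)"
    using is_basis_flat_topology bot_compact unfolding is_basis_def
    by (metis arbitrary_union_of_inc image_eqI)
  then show "(Spec :: 'a set) \<subseteq> topspace flat_topology" by (rule openin_subset)
qed

lemma topspace_MinF: "topspace (MinF :: 'a::quantale topology) = Min_Spec"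
  by (auto simp: MinF_def topspace_flat_topology Min_Spec_def)

definition mp_quantale :: "'a::quantale itself \<Rightarrow> bool" where
  "mp_quantale _ \<longleftrightarrow> (\<forall>p\<in>Spec :: 'a set. \<exists>!q. q \<in> Min_Spec \<and> q \<le> p)"

definition purified :: "'a::quantale itself \<Rightarrow> bool" where
  "purified _ \<longleftrightarrow> (\<forall>p\<in>Min_Spec :: 'a set. \<forall>q\<in>Min_Spec. p \<noteq> q \<longrightarrow>
     (\<exists>e\<in>complemented. e \<le> p \<and> annih e \<le> q))"

definition pure :: "'a::quantale \<Rightarrow> bool" where
  "pure a \<longleftrightarrow> (\<forall>c\<in>compact_elems. c \<le> a \<longrightarrow> sup a (annih c) = 1)"

definition regular :: "'a::quantale \<Rightarrow> bool" where
  "regular a \<longleftrightarrow> (\<exists>E \<subseteq> complemented. a = Sup E)"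

definition Sp :: "'a::quantale set" where
  "Sp = {r. regular r \<and> r \<noteq> 1 \<and> (\<forall>s. regular s \<and> s \<noteq> 1 \<and> r \<le> s \<longrightarrow> s = r)}"

text \<open>The empty set is connected for \<open>connectedin\<close>, so it has to be admitted here.\<close>

definition totally_disconnected_space :: "'b topology \<Rightarrow> bool" where
  "totally_disconnected_space X \<longleftrightarrow> (\<forall>S. connectedin X S \<longrightarrow> S = {} \<or> (\<exists>x. S = {x}))"

definition totally_separated_space :: "'b topology \<Rightarrow> bool" where
  "totally_separated_space X \<longleftrightarrow> (\<forall>x\<in>topspace X. \<forall>y\<in>topspace X. x \<noteq> y \<longrightarrow>
     (\<exists>U. openin X U \<and> closedin X U \<and> x \<in> U \<and> y \<notin> U))"

definition Boolean_space :: "'b topology \<Rightarrow> bool" where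
  "Boolean_space X \<longleftrightarrow> compact_space X \<and> Hausdorff_space X \<and>
     (\<exists>\<B>. is_basis X \<B> \<and> (\<forall>U\<in>\<B>. openin X U \<and> closedin X U))"

end

theory Submission
  imports Defs
begin

text \<open>
  Everything rests on one prime avoidance argument: if \<open>c\<close> is compact and \<open>c\<^sup>\<bottom> \<le> m\<close> with \<open>m\<close>
  prime, then some minimal prime below \<open>m\<close> does not contain \<open>c\<close>. It shows that in an mp-quantale
  the minimal primes are pure, that minimal primes of a purified quantale are regular, and that the
  minimal prime spectrum is always compact by a variant of the same argument. For an mp-quantale,
  \<open>MinF\<close> is then compact Hausdorff, so that components and quasi-components coincide,
  and purity of the minimal primes turns every clopen set of \<open>MinF\<close> into \<open>V e \<inter> Min_Spec\<close> for a
  complemented \<open>e\<close>.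
\<close>

section \<open>Arithmetic of quantales\<close>

lemma mult_sup_distrib:
  fixes a b c :: "'a::quantale"
  shows "a * sup b c = sup (a * b) (a * c)"
  using mult_Sup[of a "{b, c}"] by simp

lemma mult_bot [simp]:
  fixes a :: "'a::quantale"
  shows "a * bot = bot"
  using mult_Sup[of a "{}"] by simp

lemma quantale_mult_mono:
  fixes a b c d :: "'a::quantale"
  assumes "a \<le> b" "c \<le> d"
  shows "a * c \<le> b * d"
proof -
  have "a * c \<le> a * d"
    using mult_sup_distrib[of a c d] assms(2) by (simp add: sup.absorb_iff2)
  also have "\<dots> \<le> b * d"
    using mult_sup_distrib[of d a b] assms(1) by (simp add: sup.absorb_iff2 mult.commute)
  finally show ?thesis .
qed

lemma le_one [simp]:
  fixes a :: "'a::quantale"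
  shows "a \<le> 1"
  by (simp add: one_eq_top)

lemma one_le_iff:
  fixes a :: "'a::quantale"
  shows "1 \<le> a \<longleftrightarrow> a = 1"
  by (simp add: one_eq_top top_unique)

lemma mult_le_left:
  fixes a b :: "'a::quantale"
  shows "a * b \<le> a"
  using quantale_mult_mono[of a a b 1] by simp

lemma mult_le_right:
  fixes a b :: "'a::quantale"
  shows "a * b \<le> b"
  using mult_le_left[of b a] by (simp add: mult.commute)

lemma mult_annih [simp]:
  fixes a :: "'a::quantale"
  shows "a * annih a = bot"
  by (auto simp: annih_def mult_Sup bot_unique intro!: antisym SUP_least)

lemma le_annih_iff:
  fixes a x :: "'a::quantale"
  shows "x \<le> annih a \<longleftrightarrow> a * x = bot"
proof
  assume "x \<le> annih a"
  then show "a * x = bot"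
    using quantale_mult_mono[of a a x "annih a"] by (simp add: bot_unique)
qed (auto simp: annih_def intro: Sup_upper)

text \<open>Multiplying \<open>sup x y = 1\<close> by \<open>c\<close> gives
  \<open>c = sup (c * x) (c * y)\<close>. Comaximality is mostly exploited in this way, with one of
  the two products equal to \<open>bot\<close>.\<close>

lemma le_of_sup_eq_one:
  fixes c x y z :: "'a::quantale"
  assumes "sup x y = 1" "c * x \<le> z" "c * y \<le> z"
  shows "c \<le> z"
proof -
  have "c * sup x y \<le> z"
    using assms(2,3) by (simp only: mult_sup_distrib) simp
  then show ?thesis
    using assms(1) by simp
qed

lemma eq_oneI:
  fixes x y z :: "'a::quantale"
  assumes "sup x y = 1" "x \<le> z" "y \<le> z"
  shows "z = 1"
  using le_supI[OF assms(2,3)] assms(1) by (simp only: one_le_iff)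

section \<open>Complemented elements\<close>

lemma annih_complemented:
  fixes e :: "'a::quantale"
  assumes "e \<in> complemented"
  shows "annih e \<in> complemented"
proof -
  have "e \<le> annih (annih e)"
    by (simp add: le_annih_iff mult.commute)
  then have "sup (annih e) (annih (annih e)) = 1"
    using assms by - (rule eq_oneI[of e "annih e"], (auto simp: complemented_def intro: le_supI2)+)
  then show ?thesis
    by (simp add: complemented_def)
qed

lemma complementedI:
  fixes e f :: "'a::quantale"
  assumes "sup e f = 1" "e * f = bot"
  shows "e \<in> complemented"
proof -
  have "f \<le> annih e"
    using assms(2) by (simp add: le_annih_iff)
  then have "sup e (annih e) = 1"
    by - (rule eq_oneI[OF assms(1)], (auto intro: le_supI2)+)
  then show ?thesis
    by (simp add: complemented_def)
qed

text \<open>De Morgan: the complement of the join is the product of the two annihilators.\<close>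

lemma sup_complemented:
  fixes e f :: "'a::quantale"
  assumes "e \<in> complemented" "f \<in> complemented"
  shows "sup e f \<in> complemented"
proof (rule complementedI)
  let ?g = "annih e * annih f"
  have "1 * annih e \<le> sup (sup e f) ?g"
  proof (rule le_of_sup_eq_one)
    show "sup f (annih f) = 1"
      using assms(2) by (simp add: complemented_def)
    show "1 * annih e * f \<le> sup (sup e f) ?g"
      by (simp add: mult_le_right le_supI1 le_supI2)
  qed simp
  then show "sup (sup e f) ?g = 1"
    using assms(1) by - (rule eq_oneI[of e "annih e"], (auto simp: complemented_def intro: le_supI1)+)
  have "?g * e = bot" "?g * f = bot"
    by (metis mult.assoc mult.commute mult_annih mult_bot)+
  then show "sup e f * ?g = bot"
    using mult_sup_distrib[of ?g e f] by (simp add: mult.commute)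
qed

lemma Sup_complemented:
  fixes E :: "'a::quantale set"
  assumes "finite E" "E \<subseteq> complemented"
  shows "Sup E \<in> complemented"
  using assms
proof (induction E rule: finite_induct)
  case empty
  then show ?case
    by (auto intro: complementedI[where f = 1])
qed (auto intro: sup_complemented)

text \<open>A cover of \<open>e\<close> becomes a cover of 1 once \<open>annih e\<close> is added;
  multiplying a finite subcover by \<open>e\<close> removes \<open>annih e\<close> again.\<close>

lemma complemented_compact:
  fixes e :: "'a::quantale"
  assumes "(1::'a) \<in> compact_elems" "e \<in> complemented"
  shows "e \<in> compact_elems"
  unfolding compact_elems_def
proof (intro CollectI allI impI)
  fix X
  assume "e \<le> Sup X"
  then have "Sup (insert (annih e) X) = 1"
    using assms(2) by - (rule eq_oneI[of e "annih e"], (auto simp: complemented_def intro: le_supI2)+)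
  then have "1 \<le> Sup (insert (annih e) X)"
    by simp
  then obtain Y where Y: "finite Y" "Y \<subseteq> insert (annih e) X" "1 \<le> Sup Y"
    using assms(1) unfolding compact_elems_def by blast
  have "Sup Y \<le> Sup (insert (annih e) (Y - {annih e}))"
    by (intro Sup_subset_mono) auto
  from order_trans[OF Y(3) this] have "sup (annih e) (Sup (Y - {annih e})) = 1"
    by (simp only: complete_lattice_class.Sup_insert one_le_iff)
  then have "e \<le> Sup (Y - {annih e})"
    by (rule le_of_sup_eq_one) (auto simp: mult_le_right)
  then show "\<exists>Y. finite Y \<and> Y \<subseteq> X \<and> e \<le> Sup Y"
    using Y by (intro exI[of _ "Y - {annih e}"]) auto
qed

section \<open>Prime elements\<close>

lemma Spec_mult_le:
  fixes p :: "'a::quantale"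
  assumes "p \<in> Spec"
  shows "a * b \<le> p \<longleftrightarrow> a \<le> p \<or> b \<le> p"
  using assms order_trans[OF mult_le_left[of a b], of p] order_trans[OF mult_le_right[of a b], of p]
  by (auto simp: Spec_def)

lemma Spec_not_one:
  fixes p :: "'a::quantale"
  assumes "p \<in> Spec"
  shows "\<not> 1 \<le> p"
  using assms by (auto simp: Spec_def)

lemma Spec_annih_le:
  fixes p :: "'a::quantale"
  assumes "p \<in> Spec" "\<not> a \<le> p"
  shows "annih a \<le> p"
  using assms Spec_mult_le[of p a "annih a"] by simp

lemma Spec_sup_eq_one:
  fixes p :: "'a::quantale"
  assumes "p \<in> Spec" "sup a b = 1" "a \<le> p" "b \<le> p"
  shows False
  using le_supI[OF assms(3,4)] Spec_not_one[OF assms(1)] assms(2) by simp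

lemma Spec_complemented:
  fixes p :: "'a::quantale"
  assumes "p \<in> Spec" "e \<in> complemented"
  shows "annih e \<le> p \<longleftrightarrow> \<not> e \<le> p"
proof
  assume "annih e \<le> p"
  then show "\<not> e \<le> p"
    using assms Spec_sup_eq_one[of p e "annih e"] by (auto simp: complemented_def)
qed (rule Spec_annih_le[OF assms(1)])

lemma Min_Spec_Spec: "p \<in> Min_Spec \<Longrightarrow> p \<in> Spec"
  by (simp add: Min_Spec_def)

lemma Min_Spec_eqI:
  fixes p q :: "'a::quantale"
  shows "p \<in> Min_Spec \<Longrightarrow> q \<in> Spec \<Longrightarrow> q \<le> p \<Longrightarrow> q = p"
  by (simp add: Min_Spec_def)

section \<open>Existence of primes and of minimal primes by Zorn's lemma\<close>

text \<open>Zorn's lemma on the elements above \<open>a\<close> that dominate no member of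
  \<open>S\<close>. Compactness of the members of \<open>S\<close> keeps the join of a chain inside
  this family.\<close>

lemma exists_maximal_compact_avoiding:
  fixes S :: "'a::quantale set"
  assumes "S \<subseteq> compact_elems" "\<And>s. s \<in> S \<Longrightarrow> \<not> s \<le> a"
  obtains p where "a \<le> p" "\<And>s. s \<in> S \<Longrightarrow> \<not> s \<le> p"
    "\<And>x. p < x \<Longrightarrow> \<exists>s\<in>S. s \<le> x"
proof -
  define X where "X = {x. a \<le> x \<and> (\<forall>s\<in>S. \<not> s \<le> x)}"
  have "\<exists>m\<in>X. \<forall>x\<in>X. m \<le> x \<longrightarrow> x = m"
  proof (rule predicate_Zorn)
    show "partial_order_on X (relation_of (\<le>) X)"
      by (rule partial_order_on_relation_ofI) auto
    fix C
    assume C: "C \<in> Chains (relation_of (\<le>) X)"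
    then have CX: "C \<subseteq> X"
      by (rule Chains_relation_of)
    have chain: "x \<le> y \<or> y \<le> x" if "x \<in> C" "y \<in> C" for x y
      using C that by (auto simp: Chains_def relation_of_def)
    \<comment> \<open>Inserting \<open>a\<close> makes the join an upper bound in \<open>X\<close>
      even for the empty chain.\<close>
    have "\<not> s \<le> Sup (insert a C)" if s: "s \<in> S" for s
    proof
      assume "s \<le> Sup (insert a C)"
      moreover have "s \<in> compact_elems"
        using s assms(1) by blast
      ultimately obtain Y where Y: "finite Y" "Y \<subseteq> insert a C" "s \<le> Sup Y"
        unfolding compact_elems_def by blast
      have total: "x \<le> y \<or> y \<le> x" if "x \<in> insert a C" "y \<in> insert a C" for x y
        using that chain CX by (auto simp: X_def)
      have sup_in: "sup x y \<in> insert a Y" if "x \<in> insert a Y" "y \<in> insert a Y" for x y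
      proof -
        have "x \<le> y \<or> y \<le> x"
          using that Y(2) by (intro total) auto
        then have "sup x y = y \<or> sup x y = x"
          by (auto simp: sup.absorb1 sup.absorb2)
        then show ?thesis
          using that by metis
      qed
      \<comment> \<open>A finite nonempty chain contains its own join, so \<open>s\<close> would lie
        below a single element of \<open>insert a C\<close>.\<close>
      have "Sup (insert a Y) \<in> insert a Y"
        by (rule finite_Sup_in) (use Y(1) sup_in in auto)
      then have "Sup (insert a Y) \<in> insert a C"
        using Y(2) by blast
      moreover have "s \<le> Sup (insert a Y)"
        using Y(3) by (simp add: le_supI2)
      ultimately show False
        using s assms(2) CX by (auto simp: X_def)
    qed
    then have "Sup (insert a C) \<in> X"
      by (auto simp: X_def)
    moreover have "\<forall>x\<in>C. x \<le> Sup (insert a C)"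
      by (auto intro: Sup_upper le_supI2)
    ultimately show "\<exists>u\<in>X. \<forall>x\<in>C. x \<le> u"
      by blast
  qed
  then obtain m where m: "m \<in> X" "\<And>x. x \<in> X \<Longrightarrow> m \<le> x \<Longrightarrow> x = m"
    by blast
  show thesis
  proof (rule that[of m])
    show "\<exists>s\<in>S. s \<le> x" if "m < x" for x
      using m that unfolding X_def by (auto simp: less_le intro: order_trans)
  qed (use m in \<open>auto simp: X_def\<close>)
qed

text \<open>A maximal element among those above \<open>a\<close> that dominate no member of
  \<open>S\<close> is prime, just as an ideal of a ring maximal with respect to missing a
  multiplicative set is prime.\<close>

lemma prime_avoidance:
  fixes S :: "'a::quantale set"
  assumes "S \<subseteq> compact_elems" "S \<noteq> {}"
    and mult: "\<And>s t. s \<in> S \<Longrightarrow> t \<in> S \<Longrightarrow> s * t \<in> S"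
    and "\<And>s. s \<in> S \<Longrightarrow> \<not> s \<le> a"
  obtains p where "p \<in> Spec" "a \<le> p" "\<And>s. s \<in> S \<Longrightarrow> \<not> s \<le> p"
proof -
  obtain p where p: "a \<le> p" "\<And>s. s \<in> S \<Longrightarrow> \<not> s \<le> p"
    "\<And>x. p < x \<Longrightarrow> \<exists>s\<in>S. s \<le> x"
    using exists_maximal_compact_avoiding assms(1,4) by metis
  have "x \<le> p \<or> y \<le> p" if xy: "x * y \<le> p" for x y
  proof (rule ccontr)
    assume "\<not> ?thesis"
    then have "p < sup p x" "p < sup p y"
      by (simp_all add: less_le_not_le)
    then obtain s t where st: "s \<in> S" "t \<in> S" "s \<le> sup p x" "t \<le> sup p y"
      using p(3) by metis
    \<comment> \<open>Every term of the expanded product has a factor \<open>p\<close>, except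
      \<open>x * y\<close>, which is below \<open>p\<close> by assumption.\<close>
    have "s * t \<le> sup p x * sup p y"
      using st by (intro quantale_mult_mono)
    also have "\<dots> = sup (sup p x * p) (sup (y * p) (x * y))"
      using mult_sup_distrib[of "sup p x" p y] mult_sup_distrib[of y p x]
      by (simp add: mult.commute)
    also have "\<dots> \<le> p"
      using xy by (simp add: mult_le_right)
    finally show False
      using p(2) mult st(1,2) by blast
  qed
  moreover have "p < 1"
    using p(2) assms(2) by (metis le_one less_le ex_in_conv)
  ultimately have "p \<in> Spec"
    by (simp add: Spec_def)
  then show thesis
    using that p by blast
qed

lemma exists_prime_above:
  fixes a :: "'a::quantale"
  assumes "(1::'a) \<in> compact_elems" "a \<noteq> 1"
  obtains p where "p \<in> Spec" "a \<le> p"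
proof (rule prime_avoidance[of "{1}" a])
  show "{1} \<subseteq> (compact_elems :: 'a set)"
    using assms(1) by simp
qed (use assms(2) that in \<open>auto simp: one_le_iff\<close>)

text \<open>Zorn's lemma downwards: the meet of a chain of primes is prime.\<close>

lemma exists_Min_Spec_below:
  fixes p :: "'a::quantale"
  assumes "p \<in> Spec"
  obtains q where "q \<in> Min_Spec" "q \<le> p"
proof -
  define X where "X = {q \<in> Spec. q \<le> p}"
  have "\<exists>m\<in>X. \<forall>x\<in>X. m \<ge> x \<longrightarrow> x = m"
  proof (rule predicate_Zorn)
    show "partial_order_on X (relation_of (\<ge>) X)"
      by (rule partial_order_on_relation_ofI) auto
    fix C
    assume C: "C \<in> Chains (relation_of (\<ge>) X)"
    then have CX: "C \<subseteq> X"
      by (rule Chains_relation_of)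
    have chain: "x \<le> y \<or> y \<le> x" if "x \<in> C" "y \<in> C" for x y
      using C that by (auto simp: Chains_def relation_of_def)
    \<comment> \<open>Adding \<open>p\<close> keeps the meet below \<open>p\<close> for the empty
      chain as well.\<close>
    let ?C = "insert p C"
    have total: "x \<le> y \<or> y \<le> x" if "x \<in> ?C" "y \<in> ?C" for x y
      using that chain CX by (auto simp: X_def)
    have CS: "?C \<subseteq> Spec"
      using CX assms by (auto simp: X_def)
    have "a \<le> Inf ?C \<or> b \<le> Inf ?C" if ab: "a * b \<le> Inf ?C" for a b
    proof (rule ccontr)
      assume "\<not> ?thesis"
      then obtain x y where xy: "x \<in> ?C" "\<not> a \<le> x" "y \<in> ?C" "\<not> b \<le> y"
        unfolding le_Inf_iff by blast
      have "a * b \<le> z" if "z \<in> ?C" for z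
        using order_trans[OF ab Inf_lower[OF that]] .
      \<comment> \<open>Primeness of \<open>x\<close> and of \<open>y\<close> yields the other
        factor each time. Whichever of \<open>x\<close> and \<open>y\<close> is smaller, passing to
        the larger one contradicts its choice.\<close>
      then have "b \<le> x" "a \<le> y"
        using xy CS Spec_mult_le by blast+
      then show False
        using xy total[of x y] order_trans by blast
    qed
    moreover have "Inf ?C < 1"
      using assms by (simp add: Spec_def le_infI1 less_le_not_le one_le_iff)
    ultimately have "Inf ?C \<in> X"
      by (simp add: X_def Spec_def)
    moreover have "\<forall>x\<in>C. Inf ?C \<le> x"
      by (auto intro: Inf_lower le_infI2)
    ultimately show "\<exists>u\<in>X. \<forall>x\<in>C. u \<le> x"
      by blast
  qed
  then obtain m where "m \<in> X" "\<And>x. x \<in> X \<Longrightarrow> x \<le> m \<Longrightarrow> x = m"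
    by blast
  then have "m \<in> Min_Spec" "m \<le> p"
    unfolding X_def Min_Spec_def by (auto intro: order_trans)
  then show thesis
    by (rule that)
qed

text \<open>Some compact \<open>d\<close> below \<open>a\<close> is not below \<open>q\<close>;
  primeness puts \<open>annih d\<close> below \<open>q\<close>, and purity makes
  \<open>annih d\<close> comaximal with \<open>a\<close>.\<close>

lemma Spec_pure_cover:
  fixes a q :: "'a::quantale"
  assumes "algebraic TYPE('a)" "pure a" "q \<in> Spec" "\<not> a \<le> q"
  shows "sup a q = 1"
proof -
  obtain X where X: "X \<subseteq> compact_elems" "a = Sup X"
    using assms(1) unfolding algebraic_def by blast
  then obtain d where d: "d \<in> X" "\<not> d \<le> q"
    using assms(4) Sup_least by blast
  have "1 = sup a (annih d)"
    using assms(2) X d(1) Sup_upper unfolding pure_def by auto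
  also have "\<dots> \<le> sup a q"
    using Spec_annih_le[OF assms(3) d(2)] by (simp add: le_supI2)
  finally show ?thesis
    by (simp add: one_le_iff)
qed

section \<open>Bases and disconnectedness\<close>

lemma is_basis_iff:
  "is_basis X \<B> \<longleftrightarrow> (\<forall>U\<in>\<B>. openin X U) \<and>
     (\<forall>U x. openin X U \<and> x \<in> U \<longrightarrow> (\<exists>W\<in>\<B>. x \<in> W \<and> W \<subseteq> U))"
  by (simp only: is_basis_def openin_topology_base_unique Ball_def Bex_def)

lemma totally_separated_imp_disconnected:
  assumes "totally_separated_space X"
  shows "totally_disconnected_space X"
  unfolding totally_disconnected_space_def
proof (intro allI impI)
  fix S
  assume S: "connectedin X S"
  have "x = y" if "x \<in> S" "y \<in> S" for x y
  proof (rule ccontr)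
    assume "x \<noteq> y"
    moreover have "x \<in> topspace X" "y \<in> topspace X"
      using S that connectedin_subset_topspace by blast+
    ultimately obtain U where "openin X U" "closedin X U" "x \<in> U" "y \<notin> U"
      using assms unfolding totally_separated_space_def by blast
    then show False
      using connectedin_clopen_cases[OF S] that by (auto simp: disjnt_iff)
  qed
  then show "S = {} \<or> (\<exists>x. S = {x})"
    by blast
qed

text \<open>In a compact Hausdorff space components and quasi-components coincide, and a clopen set
  separates points of different quasi-components.\<close>

lemma totally_disconnected_imp_separated:
  assumes "compact_space X" "Hausdorff_space X" "totally_disconnected_space X"
  shows "totally_separated_space X"
  unfolding totally_separated_space_def
proof (intro ballI impI)
  fix x y
  assume xy: "x \<in> topspace X" "y \<in> topspace X" "x \<noteq> y"
  have "\<not> connected_component_of X x y"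
  proof
    assume "connected_component_of X x y"
    then obtain S where "connectedin X S" "x \<in> S" "y \<in> S"
      unfolding connected_component_of_def by blast
    then show False
      using assms(3) xy(3) unfolding totally_disconnected_space_def by blast
  qed
  then have "\<not> quasi_component_of X x y"
    using assms quasi_eq_connected_component_of[of X x] by simp
  then show "\<exists>U. openin X U \<and> closedin X U \<and> x \<in> U \<and> y \<notin> U"
    using xy unfolding quasi_component_of by blast
qed

text \<open>A neighbourhood of \<open>x\<close> that misses \<open>y\<close> shrinks to a clopen
  basic set.\<close>

lemma Boolean_imp_totally_separated:
  assumes "Boolean_space X"
  shows "totally_separated_space X"
  unfolding totally_separated_space_def
proof (intro ballI impI)
  fix x y
  assume "x \<in> topspace X" "y \<in> topspace X" "x \<noteq> y"
  then obtain U W where U: "openin X U" "x \<in> U" "y \<in> W" "disjnt U W"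
    using assms unfolding Boolean_space_def Hausdorff_space_def by metis
  then obtain B where "openin X B" "closedin X B" "x \<in> B" "B \<subseteq> U"
    using assms unfolding Boolean_space_def is_basis_iff by metis
  then show "\<exists>U. openin X U \<and> closedin X U \<and> x \<in> U \<and> y \<notin> U"
    using U unfolding disjnt_iff by blast
qed

section \<open>Semiprime coherent quantales\<close>

context
  fixes A :: "'a::quantale itself"
  assumes coh: "coherent A" and semi: "semiprime A"
begin

lemma one_compact: "(1::'a) \<in> compact_elems"
  using coh by (simp add: coherent_def)

lemma mult_compact: "c \<in> compact_elems \<Longrightarrow> d \<in> compact_elems \<Longrightarrow> c * d \<in> compact_elems" for c d :: 'a
  using coh by (simp add: coherent_def)

lemma compact_below:
  fixes a b :: 'a
  assumes "\<not> a \<le> b"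
  obtains c where "c \<in> compact_elems" "c \<le> a" "\<not> c \<le> b"
proof -
  obtain X where "X \<subseteq> compact_elems" "a = Sup X"
    using coh unfolding coherent_def algebraic_def by blast
  then show thesis
    using assms that Sup_upper by (auto simp: Sup_le_iff)
qed

lemma eq_bot_iff_Spec: "x = bot \<longleftrightarrow> (\<forall>p\<in>Spec. x \<le> p)" for x :: 'a
  using semi le_Inf_iff[of x Spec] by (simp add: semiprime_def bot_unique)

lemma eq_bot_iff_Min_Spec: "x = bot \<longleftrightarrow> (\<forall>p\<in>Min_Spec. x \<le> p)" for x :: 'a
proof
  assume min: "\<forall>p\<in>Min_Spec. x \<le> p"
  show "x = bot"
    unfolding eq_bot_iff_Spec
  proof
    fix p :: 'a
    assume "p \<in> Spec"
    then obtain q where "q \<in> Min_Spec" "q \<le> p"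
      by (rule exists_Min_Spec_below)
    then show "x \<le> p"
      using min order_trans by blast
  qed
qed simp

text \<open>Localization in disguise: a prime dominating no element of \<open>S\<close> lies below
  \<open>m\<close> and omits \<open>c\<close>, and so does every minimal prime under it. The
  assumption on \<open>annih c\<close> keeps \<open>bot\<close> out of \<open>S\<close>.\<close>

lemma Min_Spec_avoiding:
  fixes c m :: 'a
  assumes c: "c \<in> compact_elems" and m: "m \<in> Spec" "annih c \<le> m"
  obtains q where "q \<in> Min_Spec" "q \<le> m" "\<not> c \<le> q"
proof -
  \<comment> \<open>The saturation of the multiplicative set of all \<open>d * c ^ n\<close> with \<open>\<not> d \<le> m\<close>.\<close>
  define S where
    "S = {s \<in> compact_elems. \<exists>d. \<not> d \<le> m \<and> (\<forall>q\<in>Spec. s \<le> q \<longrightarrow> d \<le> q \<or> c \<le> q)}"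
  have cS: "c \<in> S"
    using c Spec_not_one[OF m(1)] by (auto simp: S_def)
  have mult: "s * t \<in> S" if st: "s \<in> S" "t \<in> S" for s t
  proof -
    obtain d d' where "\<not> d \<le> m" "\<forall>q\<in>Spec. s \<le> q \<longrightarrow> d \<le> q \<or> c \<le> q"
      "\<not> d' \<le> m" "\<forall>q\<in>Spec. t \<le> q \<longrightarrow> d' \<le> q \<or> c \<le> q"
      using st unfolding S_def by blast
    \<comment> \<open>Primeness of \<open>m\<close> makes \<open>d * d'\<close> a witness for
      \<open>s * t\<close>.\<close>
    then have "\<not> d * d' \<le> m \<and> (\<forall>q\<in>Spec. s * t \<le> q \<longrightarrow> d * d' \<le> q \<or> c \<le> q)"
      using m(1) by (auto simp: Spec_mult_le)
    then show ?thesis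
      using that mult_compact unfolding S_def by blast
  qed
  have nonzero: "\<not> s \<le> bot" if "s \<in> S" for s
  proof
    assume "s \<le> bot"
    then have "s \<le> q" for q
      using bot_least order_trans by blast
    with that obtain d where d: "\<not> d \<le> m" "\<forall>q\<in>Spec. d \<le> q \<or> c \<le> q"
      unfolding S_def by blast
    \<comment> \<open>By semiprimeness \<open>c * d\<close> vanishes, being below every prime; hence
      \<open>d \<le> annih c \<le> m\<close>.\<close>
    then have "c * d = bot"
      using eq_bot_iff_Spec Spec_mult_le by blast
    then show False
      using d(1) m(2) le_annih_iff order_trans by blast
  qed
  obtain p where p: "p \<in> Spec" "\<And>s. s \<in> S \<Longrightarrow> \<not> s \<le> p"
  proof (rule prime_avoidance[of S bot])
    show "S \<subseteq> compact_elems"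
      by (auto simp: S_def)
    show "S \<noteq> {}"
      using cS by blast
  qed (use mult nonzero that in auto)
  have "p \<le> m"
  proof (rule ccontr)
    assume "\<not> p \<le> m"
    then obtain d where "d \<in> compact_elems" "d \<le> p" "\<not> d \<le> m"
      by (rule compact_below)
    \<comment> \<open>Such a compact \<open>d\<close> belongs to \<open>S\<close> with itself as the
      witness.\<close>
    then show False
      using p(2) unfolding S_def by blast
  qed
  moreover obtain q where "q \<in> Min_Spec" "q \<le> p"
    using exists_Min_Spec_below p(1) by blast
  ultimately show thesis
    using that p(2) cS order_trans by metis
qed

text \<open>A minimal prime below \<open>p\<close> that omits \<open>c\<close> can only be
  \<open>p\<close>. In a reduced ring the counterpart is that an element of a minimal prime is
  killed by some element outside it.\<close>

lemma Min_Spec_annih: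
  fixes c p :: 'a
  assumes "p \<in> Min_Spec" "c \<in> compact_elems"
  shows "annih c \<le> p \<longleftrightarrow> \<not> c \<le> p"
proof
  assume "annih c \<le> p"
  then obtain q where q: "q \<in> Min_Spec" "q \<le> p" "\<not> c \<le> q"
    using Min_Spec_avoiding assms Min_Spec_Spec by blast
  then have "q = p"
    using Min_Spec_eqI assms(1) Min_Spec_Spec by blast
  then show "\<not> c \<le> p"
    using q(3) by simp
qed (use assms Spec_annih_le Min_Spec_Spec in blast)

section \<open>Minimal primes of mp-quantales\<close>

lemma mp_quantaleD:
  fixes p q m :: 'a
  assumes "mp_quantale A" "m \<in> Spec" "p \<in> Min_Spec" "q \<in> Min_Spec" "p \<le> m" "q \<le> m"
  shows "p = q"
  using assms unfolding mp_quantale_def by blast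

text \<open>As 1 is compact, two elements fail to be comaximal exactly when some prime lies above
  both.\<close>

lemma mp_quantale_iff:
  "mp_quantale A \<longleftrightarrow> (\<forall>p\<in>Min_Spec :: 'a set. \<forall>q\<in>Min_Spec. p \<noteq> q \<longrightarrow> sup p q = 1)"
proof
  assume mp: "mp_quantale A"
  show "\<forall>p\<in>Min_Spec :: 'a set. \<forall>q\<in>Min_Spec. p \<noteq> q \<longrightarrow> sup p q = 1"
  proof (intro ballI impI, rule ccontr)
    fix p q :: 'a
    assume pq: "p \<in> Min_Spec" "q \<in> Min_Spec" "p \<noteq> q" "sup p q \<noteq> 1"
    then obtain m where "m \<in> Spec" "sup p q \<le> m"
      using exists_prime_above one_compact by blast
    then show False
      using mp_quantaleD[OF mp, of m p q] pq by simp
  qed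
next
  assume comax: "\<forall>p\<in>Min_Spec :: 'a set. \<forall>q\<in>Min_Spec. p \<noteq> q \<longrightarrow> sup p q = 1"
  show "mp_quantale A"
    unfolding mp_quantale_def
  proof
    fix m :: 'a
    assume m: "m \<in> Spec"
    then obtain q where q: "q \<in> Min_Spec" "q \<le> m"
      by (rule exists_Min_Spec_below)
    then show "\<exists>!q. q \<in> Min_Spec \<and> q \<le> m"
      using comax m Spec_sup_eq_one by (intro ex1I[of _ q]) blast+
  qed
qed

text \<open>If purity failed at \<open>c\<close>, a prime above \<open>q\<close> and
  \<open>annih c\<close> would have two minimal primes below it: \<open>q\<close>, and one omitting
  \<open>c\<close>.\<close>

lemma mp_quantale_pure_Min_Spec:
  fixes q :: 'a
  assumes "mp_quantale A" "q \<in> Min_Spec"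
  shows "pure q"
  unfolding pure_def
proof (intro ballI impI, rule ccontr)
  fix c :: 'a
  assume c: "c \<in> compact_elems" "c \<le> q" "sup q (annih c) \<noteq> 1"
  then obtain m where m: "m \<in> Spec" "sup q (annih c) \<le> m"
    using exists_prime_above one_compact by blast
  then obtain r where "r \<in> Min_Spec" "r \<le> m" "\<not> c \<le> r"
    using Min_Spec_avoiding[of c m] c by auto
  then show False
    using mp_quantaleD[OF assms(1), of m q r] assms(2) m c(2) by simp
qed

section \<open>The flat topology on the minimal primes\<close>

lemma is_basis_MinF:
  "is_basis (MinF :: 'a topology) {V c \<inter> Min_Spec | c. c \<in> compact_elems}"
  unfolding is_basis_iff MinF_def openin_subtopology
proof (intro conjI ballI allI impI)
  fix W :: "'a set"
  assume "W \<in> {V c \<inter> Min_Spec | c. c \<in> compact_elems}"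
  then show "\<exists>T. openin flat_topology T \<and> W = T \<inter> Min_Spec"
    using is_basis_flat_topology[where 'a = 'a] unfolding is_basis_iff by blast
next
  fix U :: "'a set" and p
  assume "(\<exists>T. openin flat_topology T \<and> U = T \<inter> Min_Spec) \<and> p \<in> U"
  then obtain T where T: "openin flat_topology T" "U = T \<inter> Min_Spec" "p \<in> T \<inter> Min_Spec"
    by blast
  then have "\<exists>W\<in>V ` compact_elems. p \<in> W \<and> W \<subseteq> T"
    using is_basis_flat_topology[where 'a = 'a] unfolding is_basis_iff by simp
  then obtain c where "c \<in> compact_elems" "p \<in> V c" "V c \<subseteq> T"
    by blast
  then show "\<exists>W\<in>{V c \<inter> Min_Spec | c. c \<in> compact_elems}. p \<in> W \<and> W \<subseteq> U"
    using T(2,3) by (intro bexI[of _ "V c \<inter> Min_Spec"]) auto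
qed

lemma openin_MinF_V:
  "c \<in> compact_elems \<Longrightarrow> openin (MinF :: 'a topology) (V c \<inter> Min_Spec)" for c :: 'a
  using is_basis_MinF[unfolded is_basis_iff, THEN conjunct1] by auto

lemma openin_MinF_E:
  assumes "openin (MinF :: 'a topology) U" "p \<in> U"
  obtains c where "c \<in> compact_elems" "p \<in> V c \<inter> Min_Spec" "V c \<inter> Min_Spec \<subseteq> U"
proof -
  have "\<exists>W\<in>{V c \<inter> Min_Spec | c. c \<in> compact_elems}. p \<in> W \<and> W \<subseteq> U"
    using is_basis_MinF assms unfolding is_basis_iff by simp
  then show thesis
    using that by blast
qed

lemma clopen_MinF_V:
  fixes e :: 'a
  assumes "e \<in> complemented"
  shows "openin MinF (V e \<inter> Min_Spec)" "closedin MinF (V e \<inter> Min_Spec)"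
proof -
  show "openin MinF (V e \<inter> Min_Spec)"
    using assms complemented_compact one_compact openin_MinF_V by blast
  have "Min_Spec - V e \<inter> Min_Spec = V (annih e) \<inter> Min_Spec"
    using assms Spec_complemented Min_Spec_Spec by (auto simp: V_def)
  moreover have "annih e \<in> compact_elems"
    using assms annih_complemented complemented_compact one_compact by blast
  ultimately show "closedin MinF (V e \<inter> Min_Spec)"
    using openin_MinF_V[of "annih e"] by (auto simp: closedin_def topspace_MinF)
qed

section \<open>Compactness of the minimal spectrum and its compact open sets\<close>

text \<open>The compact \<open>s\<close> with \<open>V s\<close> finitely covered form a
  multiplicative set containing \<open>C\<close>. If \<open>bot\<close> is not in it, some prime
  dominates none of its elements, yet the minimal prime below that prime lies in \<open>V c\<close>
  for some \<open>c\<close> in \<open>C\<close>.\<close>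

lemma Min_Spec_cover_finite:
  fixes C :: "'a set"
  assumes C: "C \<subseteq> compact_elems" and cover: "Min_Spec \<subseteq> (\<Union>c\<in>C. V c)"
  shows "\<exists>F. finite F \<and> F \<subseteq> C \<and> Spec \<subseteq> (\<Union>c\<in>F. V c)"
proof (rule ccontr)
  assume no: "\<not> ?thesis"
  define S where "S = {s \<in> compact_elems. \<exists>F. finite F \<and> F \<subseteq> C \<and> V s \<subseteq> (\<Union>c\<in>F. V c)}"
  have CS: "C \<subseteq> S"
  proof
    fix c
    assume "c \<in> C"
    then show "c \<in> S"
      using C by (auto simp: S_def intro!: exI[of _ "{c}"])
  qed
  \<comment> \<open>\<open>V 1\<close> is empty, hence covered by the empty family; so
    \<open>S\<close> is nonempty even for empty \<open>C\<close>.\<close>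
  have oneS: "1 \<in> S"
    using one_compact Spec_not_one by (auto simp: S_def V_def intro!: exI[of _ "{}"])
  have mult: "s * t \<in> S" if st: "s \<in> S" "t \<in> S" for s t
  proof -
    obtain F G where "finite F" "F \<subseteq> C" "V s \<subseteq> (\<Union>c\<in>F. V c)"
      "finite G" "G \<subseteq> C" "V t \<subseteq> (\<Union>c\<in>G. V c)"
      using st unfolding S_def by blast
    moreover have "V (s * t) = V s \<union> V t"
      by (auto simp: V_def Spec_mult_le)
    ultimately have "finite (F \<union> G)" "F \<union> G \<subseteq> C" "V (s * t) \<subseteq> (\<Union>c\<in>F \<union> G. V c)"
      by auto
    then show ?thesis
      using that mult_compact unfolding S_def by blast
  qed
  have nonzero: "\<not> s \<le> bot" if s: "s \<in> S" for s
  proof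
    assume "s \<le> bot"
    then have "V s = Spec"
      by (auto simp: V_def bot_unique)
    then show False
      using s no by (simp add: S_def)
  qed
  obtain p where p: "p \<in> Spec" "\<And>s. s \<in> S \<Longrightarrow> \<not> s \<le> p"
  proof (rule prime_avoidance[of S bot])
    show "S \<subseteq> compact_elems"
      by (auto simp: S_def)
    show "S \<noteq> {}"
      using oneS by blast
  qed (use mult nonzero that in auto)
  then obtain q where q: "q \<in> Min_Spec" "q \<le> p"
    using exists_Min_Spec_below by blast
  then obtain c where "c \<in> C" "c \<le> q"
    using cover by (auto simp: V_def)
  then show False
    using CS p(2) q(2) order_trans by blast
qed

lemma compact_space_MinF: "compact_space (MinF :: 'a topology)"
  unfolding compact_space_alt
proof (intro allI impI)
  fix \<U> :: "'a set set"
  assume U: "(\<forall>U\<in>\<U>. openin MinF U) \<and> topspace MinF \<subseteq> \<Union>\<U>"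
  define C where "C = {c \<in> compact_elems. \<exists>U\<in>\<U>. V c \<inter> Min_Spec \<subseteq> U}"
  have "Min_Spec \<subseteq> (\<Union>c\<in>C. V c)"
  proof
    fix p :: 'a
    assume "p \<in> Min_Spec"
    then obtain U' where U': "U' \<in> \<U>" "p \<in> U'"
      using U topspace_MinF by blast
    then obtain c where "c \<in> compact_elems" "p \<in> V c \<inter> Min_Spec" "V c \<inter> Min_Spec \<subseteq> U'"
      using openin_MinF_E[of U' p] U by blast
    then show "p \<in> (\<Union>c\<in>C. V c)"
      using U' unfolding C_def by blast
  qed
  moreover have "C \<subseteq> compact_elems"
    by (auto simp: C_def)
  ultimately obtain F where F: "finite F" "F \<subseteq> C" "Spec \<subseteq> (\<Union>c\<in>F. V c)"
    using Min_Spec_cover_finite[of C] by blast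
  have "\<forall>c\<in>F. \<exists>U. U \<in> \<U> \<and> V c \<inter> Min_Spec \<subseteq> U"
    using F(2) C_def by blast
  then obtain g where g: "\<And>c. c \<in> F \<Longrightarrow> g c \<in> \<U> \<and> V c \<inter> Min_Spec \<subseteq> g c"
    by metis
  have "topspace MinF \<subseteq> \<Union>(g ` F)"
  proof
    fix p :: 'a
    assume "p \<in> topspace MinF"
    then have p: "p \<in> Min_Spec"
      by (simp add: topspace_MinF)
    then obtain c where "c \<in> F" "p \<in> V c"
      using F(3) Min_Spec_Spec by blast
    then show "p \<in> \<Union>(g ` F)"
      using g p by blast
  qed
  then show "\<exists>\<F>. finite \<F> \<and> \<F> \<subseteq> \<U> \<and> topspace MinF \<subseteq> \<Union>\<F>"
    using F(1) g by (intro exI[of _ "g ` F"]) auto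
qed

text \<open>A compact open set is a finite union of basic sets, and
  \<open>V (d * c) = V d \<union> V c\<close> merges these into one.\<close>

lemma compact_open_MinF:
  assumes "openin (MinF :: 'a topology) U" "compactin MinF U"
  obtains c :: 'a where "c \<in> compact_elems" "U = V c \<inter> Min_Spec"
proof -
  define \<U> where "\<U> = {V c \<inter> Min_Spec | c::'a. c \<in> compact_elems \<and> V c \<inter> Min_Spec \<subseteq> U}"
  have "U \<subseteq> \<Union>\<U>"
  proof
    fix p
    assume "p \<in> U"
    then obtain c where "c \<in> compact_elems" "p \<in> V c \<inter> Min_Spec" "V c \<inter> Min_Spec \<subseteq> U"
      using openin_MinF_E assms(1) by blast
    then show "p \<in> \<Union>\<U>"
      unfolding \<U>_def by blast
  qed
  moreover have "openin MinF W" if "W \<in> \<U>" for W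
    using that openin_MinF_V by (auto simp: \<U>_def)
  ultimately obtain \<F> where F: "finite \<F>" "\<F> \<subseteq> \<U>" "U \<subseteq> \<Union>\<F>"
    using compactinD[OF assms(2), of \<U>] by blast
  then have "U = \<Union>\<F>"
    unfolding \<U>_def by blast
  moreover have "\<exists>c\<in>compact_elems. \<Union>\<F> = V (c::'a) \<inter> Min_Spec"
    using F(1,2)
  proof (induction \<F> rule: finite_induct)
    case empty
    have "V (1::'a) = {}"
      using Spec_not_one by (auto simp: V_def)
    then show ?case
      using one_compact by force
  next
    case (insert W \<F>)
    then obtain c :: 'a where "c \<in> compact_elems" "\<Union>\<F> = V c \<inter> Min_Spec"
      by blast
    moreover obtain d :: 'a where "d \<in> compact_elems" "W = V d \<inter> Min_Spec"
      using insert.prems unfolding \<U>_def by blast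
    moreover have "V (d * c) = V d \<union> V c"
      by (auto simp: V_def Spec_mult_le)
    ultimately have "d * c \<in> compact_elems" "\<Union>(insert W \<F>) = V (d * c) \<inter> Min_Spec"
      using mult_compact by auto
    then show ?case
      by blast
  qed
  ultimately show thesis
    using that by blast
qed

text \<open>Compactness of 1 cuts the compact elements joining to \<open>p\<close> and to
  \<open>q\<close> down to finitely many, whose joins are again compact.\<close>

lemma sup_eq_one_compact:
  fixes p q :: 'a
  assumes "sup p q = 1"
  obtains c d where "c \<in> compact_elems" "d \<in> compact_elems" "c \<le> p" "d \<le> q" "sup c d = 1"
proof -
  obtain X where X: "X \<subseteq> compact_elems" "p = Sup X"
    using coh unfolding coherent_def algebraic_def by blast
  obtain Y where Y: "Y \<subseteq> compact_elems" "q = Sup Y"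
    using coh unfolding coherent_def algebraic_def by blast
  note XY = X Y
  then have "1 \<le> Sup (X \<union> Y)"
    using assms by (simp add: Sup_union_distrib)
  then obtain Z where Z: "finite Z" "Z \<subseteq> X \<union> Y" "1 \<le> Sup Z"
    using one_compact unfolding compact_elems_def by blast
  have fin: "Sup F \<in> compact_elems" if "finite F" "F \<subseteq> compact_elems" for F :: "'a set"
    using that
  proof (induction F rule: finite_induct)
    case empty
    show ?case
      by (simp add: bot_compact)
  qed (simp add: sup_compact)
  have "Z = Z \<inter> X \<union> Z \<inter> Y"
    using Z(2) by blast
  then have "sup (Sup (Z \<inter> X)) (Sup (Z \<inter> Y)) = 1"
    using Z(3) by (metis Sup_union_distrib one_le_iff)
  moreover have "Sup (Z \<inter> X) \<le> p" "Sup (Z \<inter> Y) \<le> q"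
    using XY by (auto intro: Sup_subset_mono)
  moreover have "Sup (Z \<inter> X) \<in> compact_elems" "Sup (Z \<inter> Y) \<in> compact_elems"
    by (rule fin; use Z(1) XY in blast)+
  ultimately show thesis
    using that by blast
qed

section \<open>Separation and clopen sets for mp-quantales\<close>

text \<open>Comaximal compact elements \<open>c \<le> p\<close> and \<open>d \<le> q\<close> give
  disjoint neighbourhoods \<open>V c\<close> and \<open>V d\<close>.\<close>

lemma mp_quantale_Hausdorff:
  assumes "mp_quantale A"
  shows "Hausdorff_space (MinF :: 'a topology)"
  unfolding Hausdorff_space_def topspace_MinF
proof (intro allI impI)
  fix p q :: 'a
  assume pq: "p \<in> Min_Spec \<and> q \<in> Min_Spec \<and> p \<noteq> q"
  then obtain c d where cd: "c \<in> compact_elems" "d \<in> compact_elems" "c \<le> p" "d \<le> q" "sup c d = 1"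
    using assms sup_eq_one_compact unfolding mp_quantale_iff by metis
  moreover have "disjnt (V c \<inter> Min_Spec) (V d \<inter> Min_Spec)"
    using Spec_sup_eq_one[OF _ cd(5)] by (auto simp: disjnt_def V_def)
  moreover have "p \<in> V c \<inter> Min_Spec" "q \<in> V d \<inter> Min_Spec"
    using pq cd Min_Spec_Spec by (auto simp: V_def)
  ultimately show "\<exists>U W. openin MinF U \<and> openin MinF W \<and> p \<in> U \<and> q \<in> W \<and> disjnt U W"
    using openin_MinF_V by blast
qed

text \<open>The passage from topology back to algebra. A clopen set and its complement are compact
  open, hence given by compact elements \<open>c\<close> and \<open>d\<close>; then
  \<open>annih d\<close> and \<open>annih c\<close> are complements of each other.\<close>

lemma mp_quantale_clopen:
  assumes mp: "mp_quantale A" and U: "openin (MinF :: 'a topology) U" "closedin MinF U"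
  obtains e :: 'a where "e \<in> complemented" "U = V e \<inter> Min_Spec"
proof -
  have compactin: "compactin MinF W" if "closedin MinF W" for W :: "'a set"
    using closedin_compact_space[OF compact_space_MinF that] .
  obtain c :: 'a where c: "c \<in> compact_elems" "U = V c \<inter> Min_Spec"
    using compact_open_MinF[OF U(1) compactin[OF U(2)]] by blast
  have "openin MinF (Min_Spec - U)" "closedin MinF (Min_Spec - U)"
    using U closedin_def[of MinF U] openin_closedin_eq[of MinF U] by (simp_all add: topspace_MinF)
  then obtain d :: 'a where d: "d \<in> compact_elems" "Min_Spec - U = V d \<inter> Min_Spec"
    using compact_open_MinF compactin by blast
  have cd: "d \<le> p \<longleftrightarrow> \<not> c \<le> p" if "p \<in> Min_Spec" for p
    using c(2) d(2) that Min_Spec_Spec by (auto simp: V_def)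
  \<comment> \<open>A minimal prime \<open>q\<close> below such an \<open>m\<close> dominates
    \<open>c\<close> or \<open>d\<close>; by purity the corresponding annihilator is comaximal with
    \<open>q\<close>, although both lie below \<open>m\<close>.\<close>
  have one: "sup (annih d) (annih c) = 1"
  proof (rule ccontr)
    assume "sup (annih d) (annih c) \<noteq> 1"
    then obtain m where m: "m \<in> Spec" "annih d \<le> m" "annih c \<le> m"
      using exists_prime_above[OF one_compact] by (metis le_sup_iff)
    then obtain q where q: "q \<in> Min_Spec" "q \<le> m"
      using exists_Min_Spec_below by blast
    then have "sup q (annih c) = 1 \<or> sup q (annih d) = 1"
      using mp_quantale_pure_Min_Spec[OF mp] cd c(1) d(1) unfolding pure_def by blast
    then show False
      using m q Spec_sup_eq_one by blast
  qed
  \<comment> \<open>Each minimal prime omits \<open>c\<close> or \<open>d\<close>, hence dominates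
    the corresponding annihilator; semiprimeness does the rest.\<close>
  moreover have "annih d * annih c = bot"
    unfolding eq_bot_iff_Min_Spec using cd c(1) d(1) Min_Spec_annih
    by (auto simp: Spec_mult_le Min_Spec_Spec)
  ultimately have "annih d \<in> complemented"
    by (rule complementedI)
  \<comment> \<open>For a minimal prime \<open>p\<close>, the conditions
    \<open>annih d \<le> p\<close>, \<open>\<not> d \<le> p\<close> and \<open>c \<le> p\<close> are
    equivalent.\<close>
  moreover have "U = V (annih d) \<inter> Min_Spec"
    unfolding c(2) using cd Min_Spec_annih d(1) by (auto simp: V_def)
  ultimately show thesis
    by (rule that)
qed

section \<open>Purified quantales\<close>

lemma purified_mp_quantale:
  assumes "purified A"
  shows "mp_quantale A"
  unfolding mp_quantale_iff
proof (intro ballI impI)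
  fix p q :: 'a
  assume "p \<in> Min_Spec" "q \<in> Min_Spec" "p \<noteq> q"
  then obtain e where e: "e \<in> complemented" "e \<le> p" "annih e \<le> q"
    using assms unfolding purified_def by blast
  show "sup p q = 1"
  proof (rule eq_oneI)
    show "sup e (annih e) = 1"
      using e(1) by (simp add: complemented_def)
    show "e \<le> sup p q"
      using e(2) by (rule le_supI1)
    show "annih e \<le> sup p q"
      using e(3) by (rule le_supI2)
  qed
qed

text \<open>The largest regular element \<open>?r\<close> below \<open>p\<close> is
  \<open>p\<close>. Otherwise there are a prime \<open>m\<close> above \<open>?r\<close> and a
  minimal prime \<open>q \<le> m\<close> different from \<open>p\<close>; a complemented element
  splitting \<open>p\<close> and \<open>q\<close> would lie below \<open>m\<close> together with its
  complement.\<close>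

lemma purified_regular:
  fixes p :: 'a
  assumes "purified A" "p \<in> Min_Spec"
  shows "regular p"
proof -
  let ?r = "Sup {e \<in> complemented. e \<le> p}"
  have "p \<le> ?r"
  proof (rule ccontr)
    assume "\<not> p \<le> ?r"
    then obtain c where c: "c \<in> compact_elems" "c \<le> p" "\<not> c \<le> ?r"
      by (rule compact_below)
    \<comment> \<open>Comaximality would give \<open>c = c * ?r \<le> ?r\<close>.\<close>
    have "sup ?r (annih c) \<noteq> 1"
      using c(3) le_of_sup_eq_one[of ?r "annih c" c ?r] by (auto simp: mult_le_right)
    then obtain m where "m \<in> Spec" "sup ?r (annih c) \<le> m"
      by (rule exists_prime_above[OF one_compact])
    then have m: "m \<in> Spec" "?r \<le> m" "annih c \<le> m"
      by (simp_all only: le_sup_iff)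
    then obtain q where q: "q \<in> Min_Spec" "q \<le> m" "\<not> c \<le> q"
      using Min_Spec_avoiding c(1) by blast
    then have "p \<noteq> q"
      using c(2) by blast
    then obtain e where e: "e \<in> complemented" "e \<le> p" "annih e \<le> q"
      using assms q(1) unfolding purified_def by blast
    then have "e \<le> ?r"
      by (intro Sup_upper) simp
    then have "e \<le> m" "annih e \<le> m"
      using order_trans m(2) e(3) q(2) by blast+
    then show False
      using e(1) m(1) Spec_complemented by blast
  qed
  moreover have "?r \<le> p"
    by (auto intro: Sup_least)
  ultimately show ?thesis
    unfolding regular_def by (intro exI[of _ "{e \<in> complemented. e \<le> p}"]) auto
qed

text \<open>For the converse, minimality excludes \<open>p \<le> q\<close>, so some complemented
  \<open>e\<close> in a family with join \<open>p\<close> is not below \<open>q\<close>; then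
  \<open>annih e\<close> is.\<close>

lemma purified_iff_regular: "purified A \<longleftrightarrow> (\<forall>p\<in>Min_Spec :: 'a set. regular p)"
proof
  assume reg: "\<forall>p\<in>Min_Spec :: 'a set. regular p"
  show "purified A"
    unfolding purified_def
  proof (intro ballI impI)
    fix p q :: 'a
    assume pq: "p \<in> Min_Spec" "q \<in> Min_Spec" "p \<noteq> q"
    then obtain E where E: "E \<subseteq> complemented" "p = Sup E"
      using reg unfolding regular_def by blast
    have "\<not> p \<le> q"
      using pq Min_Spec_eqI Min_Spec_Spec by blast
    then obtain e where "e \<in> E" "\<not> e \<le> q"
      using E(2) Sup_least by blast
    then show "\<exists>e\<in>complemented. e \<le> p \<and> annih e \<le> q"
      using E pq(2) Min_Spec_Spec Spec_annih_le Sup_upper by blast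
  qed
qed (use purified_regular in blast)

lemma purified_iff_basis:
  "purified A \<longleftrightarrow> is_basis (MinF :: 'a topology) {V e \<inter> Min_Spec | e. e \<in> complemented}"
proof
  assume pur: "purified A"
  show "is_basis (MinF :: 'a topology) {V e \<inter> Min_Spec | e. e \<in> complemented}"
    unfolding is_basis_iff
  proof (intro conjI ballI allI impI)
    fix U :: "'a set" and p
    assume "openin MinF U \<and> p \<in> U"
    then obtain c where c: "c \<in> compact_elems" "p \<in> V c \<inter> Min_Spec" "V c \<inter> Min_Spec \<subseteq> U"
      using openin_MinF_E by blast
    then obtain E where E: "E \<subseteq> complemented" "p = Sup E"
      using purified_regular[OF pur] unfolding regular_def by blast
    then have "c \<le> Sup E"
      using c(2) by (simp add: V_def)
    \<comment> \<open>Compactness of \<open>c\<close> yields a finite subjoin above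
      \<open>c\<close>. It is complemented, and \<open>V\<close> of it lies inside
      \<open>V c\<close>.\<close>
    then obtain F where F: "finite F" "F \<subseteq> E" "c \<le> Sup F"
      using c(1) unfolding compact_elems_def by blast
    have "Sup F \<in> complemented"
      using F E by (intro Sup_complemented) auto
    have "Sup F \<le> p"
      using F E Sup_subset_mono by blast
    have "V (Sup F) \<inter> Min_Spec \<subseteq> U"
      using c(3) order_trans[OF F(3)] unfolding V_def by blast
    moreover have "p \<in> V (Sup F) \<inter> Min_Spec"
      using c(2) \<open>Sup F \<le> p\<close> by (simp add: V_def)
    ultimately show "\<exists>W\<in>{V e \<inter> Min_Spec | e. e \<in> complemented}. p \<in> W \<and> W \<subseteq> U"
      using \<open>Sup F \<in> complemented\<close> by blast
  qed (use clopen_MinF_V in blast)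
next
  assume basis: "is_basis (MinF :: 'a topology) {V e \<inter> Min_Spec | e. e \<in> complemented}"
  show "purified A"
    unfolding purified_def
  proof (intro ballI impI)
    fix p q :: 'a
    assume pq: "p \<in> Min_Spec" "q \<in> Min_Spec" "p \<noteq> q"
    then have "\<not> p \<le> q"
      using Min_Spec_eqI Min_Spec_Spec by blast
    then obtain c where c: "c \<in> compact_elems" "c \<le> p" "\<not> c \<le> q"
      by (rule compact_below)
    then have "openin MinF (V c \<inter> Min_Spec)" "p \<in> V c \<inter> Min_Spec"
      using pq openin_MinF_V Min_Spec_Spec by (auto simp: V_def)
    then have "\<exists>W\<in>{V e \<inter> Min_Spec | e. e \<in> complemented}. p \<in> W \<and> W \<subseteq> V c \<inter> Min_Spec"
      by (rule basis[unfolded is_basis_iff, THEN conjunct2, rule_format, OF conjI])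
    then obtain e where e: "e \<in> complemented" "p \<in> V e \<inter> Min_Spec"
      "V e \<inter> Min_Spec \<subseteq> V c \<inter> Min_Spec"
      by blast
    then have "e \<le> p" "\<not> e \<le> q"
      using c(3) pq(2) Min_Spec_Spec by (auto simp: V_def)
    then show "\<exists>e\<in>complemented. e \<le> p \<and> annih e \<le> q"
      using e(1) pq(2) Min_Spec_Spec Spec_annih_le by blast
  qed
qed

text \<open>A splitting \<open>e\<close> gives the separating clopen set
  \<open>V e \<inter> Min_Spec\<close>; conversely \<open>mp_quantale_clopen\<close> extracts
  \<open>e\<close> from a separating clopen set.\<close>

lemma purified_iff_totally_separated:
  "purified A \<longleftrightarrow> mp_quantale A \<and> totally_separated_space (MinF :: 'a topology)"
proof
  assume pur: "purified A"
  have "\<exists>U. openin MinF U \<and> closedin MinF U \<and> p \<in> U \<and> q \<notin> U"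
    if pq: "p \<in> Min_Spec" "q \<in> Min_Spec" "p \<noteq> q" for p q :: 'a
  proof -
    obtain e where e: "e \<in> complemented" "e \<le> p" "annih e \<le> q"
      using pur pq unfolding purified_def by blast
    then have "p \<in> V e \<inter> Min_Spec" "q \<notin> V e \<inter> Min_Spec"
      using pq Min_Spec_Spec Spec_complemented by (auto simp: V_def)
    then show ?thesis
      using clopen_MinF_V[OF e(1)] by blast
  qed
  then show "mp_quantale A \<and> totally_separated_space (MinF :: 'a topology)"
    using pur purified_mp_quantale unfolding totally_separated_space_def topspace_MinF by blast
next
  assume sep: "mp_quantale A \<and> totally_separated_space (MinF :: 'a topology)"
  show "purified A"
    unfolding purified_def
  proof (intro ballI impI)
    fix p q :: 'a
    assume pq: "p \<in> Min_Spec" "q \<in> Min_Spec" "p \<noteq> q"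
    then obtain U where U: "openin MinF U" "closedin MinF U" "p \<in> U" "q \<notin> U"
      using sep unfolding totally_separated_space_def topspace_MinF by blast
    then obtain e where "e \<in> complemented" "U = V e \<inter> Min_Spec"
      using sep mp_quantale_clopen by metis
    then show "\<exists>e\<in>complemented. e \<le> p \<and> annih e \<le> q"
      using U pq Min_Spec_Spec Spec_annih_le by (auto simp: V_def)
  qed
qed

lemma purified_iff_totally_disconnected:
  "purified A \<longleftrightarrow> mp_quantale A \<and> totally_disconnected_space (MinF :: 'a topology)"
  using purified_iff_totally_separated totally_separated_imp_disconnected
    totally_disconnected_imp_separated compact_space_MinF mp_quantale_Hausdorff by blast

lemma purified_iff_Boolean:
  "purified A \<longleftrightarrow> mp_quantale A \<and> Boolean_space (MinF :: 'a topology)"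
proof
  assume pur: "purified A"
  then have "\<exists>\<B>. is_basis (MinF :: 'a topology) \<B> \<and> (\<forall>U\<in>\<B>. openin MinF U \<and> closedin MinF U)"
    using clopen_MinF_V purified_iff_basis
    by (intro exI[of _ "{V e \<inter> Min_Spec | e. e \<in> complemented}"]) auto
  then show "mp_quantale A \<and> Boolean_space (MinF :: 'a topology)"
    using pur purified_mp_quantale compact_space_MinF mp_quantale_Hausdorff
    unfolding Boolean_space_def by blast
qed (use purified_iff_totally_separated Boolean_imp_totally_separated in blast)

section \<open>Max-regular elements and pure elements\<close>

text \<open>A regular element other than 1 lies below some prime, hence below each minimal prime
  under that prime. As minimal primes are themselves regular, they are exactly the maximal
  ones.\<close>

lemma purified_iff_Sp: "purified A \<longleftrightarrow> (Min_Spec :: 'a set) = Sp"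
proof
  assume "purified A"
  then have reg: "regular p" if "p \<in> Min_Spec" for p :: 'a
    using that purified_regular by blast
  \<comment> \<open>Nested primes dominate the same complemented elements, hence the same regular
    elements.\<close>
  have below: "s \<le> q" if s: "regular s" "s \<le> m" "m \<in> Spec" "q \<in> Spec" "q \<le> m" for s m q :: 'a
  proof -
    obtain E where E: "E \<subseteq> complemented" "s = Sup E"
      using s(1) unfolding regular_def by blast
    have "e \<le> q" if "e \<in> E" for e
    proof (rule ccontr)
      assume "\<not> e \<le> q"
      then have "annih e \<le> m"
        using s Spec_annih_le order_trans by blast
      moreover have "e \<le> m"
        using that E(2) s(2) Sup_upper order_trans by blast
      ultimately show False
        using E(1) that s(3) Spec_complemented by blast
    qed
    then show ?thesis
      using E(2) Sup_least by blast
  qed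
  show "(Min_Spec :: 'a set) = Sp"
  proof (intro equalityI subsetI)
    fix p :: 'a
    assume p: "p \<in> Min_Spec"
    have "s = p" if s: "regular s" "s \<noteq> 1" "p \<le> s" for s
    proof -
      obtain m where "m \<in> Spec" "s \<le> m"
        using exists_prime_above one_compact s(2) by blast
      then have "s \<le> p"
        using below s p Min_Spec_Spec order_trans by blast
      then show ?thesis
        using s(3) by simp
    qed
    moreover have "p \<noteq> 1"
      using p Min_Spec_Spec Spec_not_one by blast
    ultimately show "p \<in> Sp"
      using reg p unfolding Sp_def by blast
  next
    fix r :: 'a
    assume r: "r \<in> Sp"
    then obtain m where m: "m \<in> Spec" "r \<le> m"
      using exists_prime_above one_compact unfolding Sp_def by blast
    obtain q where q: "q \<in> Min_Spec" "q \<le> m"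
      using exists_Min_Spec_below m(1) by blast
    then have "r \<le> q"
      using below r m Min_Spec_Spec unfolding Sp_def by blast
    moreover have "q \<noteq> 1"
      using q(1) Min_Spec_Spec Spec_not_one by blast
    ultimately have "q = r"
      using r reg q(1) unfolding Sp_def by blast
    then show "r \<in> Min_Spec"
      using q(1) by simp
  qed
next
  assume "(Min_Spec :: 'a set) = Sp"
  then show "purified A"
    unfolding purified_iff_regular Sp_def by blast
qed

text \<open>The scheme of \<open>purified_regular\<close> with \<open>a\<close> in place of
  \<open>p\<close>. Here the contradiction at \<open>m\<close> comes from a complemented element
  below a minimal prime \<open>q \<le> m\<close> whose complement is below \<open>a\<close>, hence
  below \<open>?r\<close>.\<close>

lemma purified_pure_regular:
  fixes a :: 'a
  assumes pur: "purified A" and a: "pure a"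
  shows "regular a"
proof -
  let ?r = "Sup {e \<in> complemented. e \<le> a}"
  have "a \<le> ?r"
  proof (rule ccontr)
    assume "\<not> a \<le> ?r"
    then obtain c where c: "c \<in> compact_elems" "c \<le> a" "\<not> c \<le> ?r"
      by (rule compact_below)
    have "sup ?r (annih c) \<noteq> 1"
      using c(3) le_of_sup_eq_one[of ?r "annih c" c ?r] by (auto simp: mult_le_right)
    then obtain m where "m \<in> Spec" "sup ?r (annih c) \<le> m"
      by (rule exists_prime_above[OF one_compact])
    then have m: "m \<in> Spec" "?r \<le> m" "annih c \<le> m"
      by (simp_all only: le_sup_iff)
    have "sup a (annih c) = 1"
      using a c unfolding pure_def by blast
    then have am: "\<not> a \<le> m"
      using m Spec_sup_eq_one by blast
    obtain q where q: "q \<in> Min_Spec" "q \<le> m"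
      using exists_Min_Spec_below m(1) by blast
    have "sup a q = 1"
    proof (rule Spec_pure_cover)
      show "algebraic TYPE('a)"
        using coh by (simp add: coherent_def algebraic_def)
      show "\<not> a \<le> q"
        using am q(2) order_trans by blast
    qed (use a q Min_Spec_Spec in auto)
    then obtain b d where bd: "b \<le> a" "d \<in> compact_elems" "d \<le> q" "sup b d = 1"
      using sup_eq_one_compact by blast
    have d: "d \<in> compact_elems" "sup a d = 1"
      using bd eq_oneI[of b d "sup a d"] by (auto intro: le_supI1)
    \<comment> \<open>Regularity of \<open>q\<close> and compactness of \<open>d\<close> enlarge
      \<open>d\<close> to a complemented element that is still below \<open>q\<close>.\<close>
    obtain E where E: "E \<subseteq> complemented" "q = Sup E"
      using purified_regular[OF pur q(1)] unfolding regular_def by blast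
    then obtain F where F: "finite F" "F \<subseteq> E" "d \<le> Sup F"
      using bd(2,3) unfolding compact_elems_def by blast
    let ?e = "Sup F"
    have e: "?e \<in> complemented" "?e \<le> q"
      using E F by (auto intro: Sup_complemented Sup_subset_mono)
    \<comment> \<open>Since \<open>sup a d = 1\<close> and
      \<open>annih ?e * d \<le> annih ?e * ?e = bot\<close>, the element \<open>annih ?e\<close>
      equals \<open>annih ?e * a\<close>.\<close>
    have "annih ?e \<le> a"
    proof (rule le_of_sup_eq_one[OF d(2)])
      have "annih ?e * d \<le> annih ?e * ?e"
        using F(3) by (intro quantale_mult_mono) auto
      then show "annih ?e * d \<le> a"
        by (simp add: mult.commute bot_unique)
    qed (rule mult_le_right)
    then have "annih ?e \<le> ?r"
      using annih_complemented[OF e(1)] by (intro Sup_upper) simp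
    then have "annih ?e \<le> m"
      using m(2) by (rule order_trans)
    moreover have "?e \<le> m"
      using e(2) q(2) by (rule order_trans)
    ultimately show False
      using e(1) m(1) Spec_complemented by blast
  qed
  moreover have "?r \<le> a"
    by (auto intro: Sup_least)
  ultimately show ?thesis
    unfolding regular_def by (intro exI[of _ "{e \<in> complemented. e \<le> a}"]) auto
qed

text \<open>For the converse, the minimal primes of an mp-quantale are pure, hence regular by
  assumption.\<close>

lemma purified_iff_pure_regular:
  "purified A \<longleftrightarrow> mp_quantale A \<and> (\<forall>a::'a. pure a \<longrightarrow> regular a)"
  using purified_pure_regular purified_mp_quantale mp_quantale_pure_Min_Spec purified_iff_regular
  by blast

end

theorem theorem7p5:
  fixes A :: "'a::quantale itself"
  assumes "coherent A" and "semiprime A"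
  shows
    "(purified A \<longleftrightarrow> mp_quantale A \<and> totally_separated_space (MinF :: 'a topology)) \<and>
     (purified A \<longleftrightarrow> mp_quantale A \<and> totally_disconnected_space (MinF :: 'a topology)) \<and>
     (purified A \<longleftrightarrow> mp_quantale A \<and> Boolean_space (MinF :: 'a topology)) \<and>
     (purified A \<longleftrightarrow> is_basis (MinF :: 'a topology) {V e \<inter> Min_Spec | e. e \<in> complemented}) \<and>
     (purified A \<longleftrightarrow> (\<forall>p\<in>Min_Spec :: 'a set. regular p)) \<and>
     (purified A \<longleftrightarrow> (Min_Spec :: 'a set) = Sp) \<and>
     (purified A \<longleftrightarrow> mp_quantale A \<and> (\<forall>a::'a. pure a \<longrightarrow> regular a))"
  using purified_iff_totally_separated[OF assms] purified_iff_totally_disconnected[OF assms]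
    purified_iff_Boolean[OF assms] purified_iff_basis[OF assms] purified_iff_regular[OF assms]
    purified_iff_Sp[OF assms] purified_iff_pure_regular[OF assms]
  by blast

end
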